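(* Let $M$ be a left-cancellative monoid with no nontrivial invertible element and let $S$ be a Garside family in $M$. Then, for every $S$-word $w$ of length $p$, there exists a unique $S$-normal word $N^{S}(w)$ of length $p$ that represents the same element of $M$ as $w$. Moreover, for $p\ge 2$, one has $$N^{S}(w) = \overline{N^{S}}_{\delta_p}(w),$$ where $\delta_p$ is inductively defined by $\delta_2 := 1$ and $\delta_p := \mathrm{sh}(\delta_{p-1}) \mid 1 \mid 2 \mid \cdots \mid p-1$, with $\mathrm{sh}$ the shift of all entries by $+1$ (so $\delta_3 = 2|1|2$, $\delta_4=3|2|3|1|2|3$, etc.).
   Context: In a monoid $M$, $f\preccurlyeq g$ (left-divisibility) means $\exists g'\in M\ (fg'=g)$. An $S$-word $s_1|\cdots|s_p$ (finite sequence of elements of $S\subseteq M$) represents the element $s_1\cdots s_p$ of $M$. For $M$ left-cancellative and $S\subseteq M$, a length-two $S$-word $s_1|s_2$ is $S$-normal if $\forall s\in S\ \forall f\in M\ (s\preccurlyeq f s_1 s_2 \Rightarrow s\preccurlyeq f s_1)$. An $S$-word $s_1|\cdots|s_p$ is $S$-normal if $s_i|s_{i+1}$ is $S$-normal for every $i<p$ (so words of length at most one are $S$-normal). For $M$ left-cancellative with no nontrivial invertible element, a subset $S$ of $M$ containing $1$ is a Garside family in $M$ if every element $g$ of $M$ has an $S$-normal decomposition, that is, there is an $S$-normal $S$-word $s_1|\cdots|s_p$ with $s_1\cdots s_p=g$. Notation: $S^{[2]}$ is the set of $S$-words of length two, and $\overline{N^{S}}$ is the restriction of $N^S$ to $S^{[2]}$.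 For a map $F: S^{[2]}\to S^{[2]}$ and $i\ge1$, $F_i$ is the partial map on $S^*$ that applies $F$ to the entries in positions $i$ and $i+1$; for a finite sequence $u=i_1|\cdots|i_n$ of positive integers, $F_u := F_{i_n}\circ\cdots\circ F_{i_1}$ ($F_{i_1}$ is applied first). *)

theory Defs
  imports "HOL-Algebra.Divisibility"
begin

text \<open>
  Left-divisibility is the library relation \<open>a divides\<^bsub>M\<^esub> b\<close>, which unfolds to
  \<open>\<exists>c\<in>carrier M. b = a \<otimes>\<^bsub>M\<^esub> c\<close> and does not presuppose commutativity.
  The set of \<open>S\<close>-words is \<open>lists S\<close>; words are indexed from 0 as lists, but positions in
  \<open>apply_at\<close> and in position sequences are counted from 1.
\<close>

definition word_prod :: "('a, 'b) monoid_scheme \<Rightarrow> 'a list \<Rightarrow> 'a"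
  where "word_prod M w = foldr (\<otimes>\<^bsub>M\<^esub>) w \<one>\<^bsub>M\<^esub>"

definition normal_pair :: "('a, 'b) monoid_scheme \<Rightarrow> 'a set \<Rightarrow> 'a \<Rightarrow> 'a \<Rightarrow> bool"
  where "normal_pair M S s\<^sub>1 s\<^sub>2 \<longleftrightarrow>
    (\<forall>s\<in>S. \<forall>f\<in>carrier M.
      s divides\<^bsub>M\<^esub> (f \<otimes>\<^bsub>M\<^esub> s\<^sub>1 \<otimes>\<^bsub>M\<^esub> s\<^sub>2) \<longrightarrow> s divides\<^bsub>M\<^esub> (f \<otimes>\<^bsub>M\<^esub> s\<^sub>1))"

definition normal_word :: "('a, 'b) monoid_scheme \<Rightarrow> 'a set \<Rightarrow> 'a list \<Rightarrow> bool"
  where "normal_word M S w \<longleftrightarrow> w \<in> lists S \<and> successively (normal_pair M S) w"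

text \<open>
  This is the notion of Garside family appropriate to a left-cancellative monoid whose only
  invertible element is \<open>\<one>\<close>; these conditions on \<open>M\<close> are not part of the predicate.
\<close>

definition garside_family :: "('a, 'b) monoid_scheme \<Rightarrow> 'a set \<Rightarrow> bool"
  where "garside_family M S \<longleftrightarrow>
    S \<subseteq> carrier M \<and> \<one>\<^bsub>M\<^esub> \<in> S \<and>
    (\<forall>g\<in>carrier M. \<exists>w. normal_word M S w \<and> word_prod M w = g)"

definition normal_form_of :: "('a, 'b) monoid_scheme \<Rightarrow> 'a set \<Rightarrow> 'a list \<Rightarrow> 'a list \<Rightarrow> bool"
  where "normal_form_of M S w v \<longleftrightarrow>
    normal_word M S v \<and> length v = length w \<and> word_prod M v = word_prod M w"

text \<open>The map \<open>N\<^sup>S\<close>; meaningful only where \<open>normal_form_of M S w\<close> has a unique solution.\<close>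

definition NS :: "('a, 'b) monoid_scheme \<Rightarrow> 'a set \<Rightarrow> 'a list \<Rightarrow> 'a list"
  where "NS M S w = (THE v. normal_form_of M S w v)"

text \<open>The restriction of \<open>N\<^sup>S\<close> to \<open>S\<close>-words of length two, as a partial map with exactly that domain.\<close>

definition NS_bar :: "('a, 'b) monoid_scheme \<Rightarrow> 'a set \<Rightarrow> 'a list \<rightharpoonup> 'a list"
  where "NS_bar M S = (\<lambda>w. Some (NS M S w)) |` {w \<in> lists S. length w = 2}"

text \<open>\<open>apply_at F i\<close> is \<open>F\<^sub>i\<close>: it replaces the entries in positions \<open>i\<close>, \<open>i + 1\<close> by their image under \<open>F\<close>.\<close>

definition apply_at :: "('a list \<rightharpoonup> 'a list) \<Rightarrow> nat \<Rightarrow> 'a list \<rightharpoonup> 'a list"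
  where "apply_at F i w =
    (if 1 \<le> i \<and> i < length w
     then map_option (\<lambda>v. take (i - 1) w @ v @ drop (i + 1) w) (F [w ! (i - 1), w ! i])
     else None)"

text \<open>\<open>apply_seq F u\<close> is \<open>F\<^sub>u\<close>: the first entry of \<open>u\<close> acts first.\<close>

primrec apply_seq :: "('a list \<rightharpoonup> 'a list) \<Rightarrow> nat list \<Rightarrow> 'a list \<rightharpoonup> 'a list"
  where
    "apply_seq F [] = Some"
  | "apply_seq F (i # u) = apply_seq F u \<circ>\<^sub>m apply_at F i"

text \<open>The sequence \<open>\<delta>\<^sub>p\<close>; the values for \<open>p < 2\<close> are irrelevant.\<close>

fun delta :: "nat \<Rightarrow> nat list"
  where
    "delta 0 = []"
  | "delta (Suc 0) = []"
  | "delta (Suc (Suc 0)) = [1]"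
  | "delta (Suc (Suc (Suc n))) = map Suc (delta (Suc (Suc n))) @ [1..<Suc (Suc (Suc n))]"

lemma delta_2: "delta 2 = [1]"
  by (simp add: numeral_2_eq_2)

lemma delta_rec: "p \<ge> 3 \<Longrightarrow> delta p = map Suc (delta (p - 1)) @ [1..<p]"
  by (cases p rule: delta.cases) auto

lemma delta_3: "delta 3 = [2, 1, 2]"
  by (simp add: numeral_eq_Suc upt_rec)

lemma delta_4: "delta 4 = [3, 2, 3, 1, 2, 3]"
  by (simp add: numeral_eq_Suc upt_rec)

end

theory Submission
  imports Defs
begin

text \<open>
  Divisibility by an element of \<open>S\<close> is decided by the first entry of a normal word, even after
  multiplication by any \<open>f\<close> on the left. With \<open>f = \<one>\<close> and antisymmetry of divisibility this gives
  uniqueness. With general \<open>f\<close> it shows that the entries of a word \<open>w\<close> can be absorbed one by one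
  by those of any normal decomposition of its product, so that all entries of the latter beyond
  position \<open>length w\<close> are invertible, hence trivial. Finally, inserting a new letter on the left of
  a normal word by normalising positions \<open>1, 2, \<dots>\<close> successively keeps the word normal.
\<close>

section \<open>Shifted position sequences\<close>

text \<open>A position above 1 never touches the head. The bound on \<open>i\<close> matters:
  \<open>apply_at F 0\<close> is undefined everywhere, while \<open>apply_at F 1\<close> acts on the
  head.\<close>

lemma apply_at_Suc_Cons:
  "i \<ge> 1 \<Longrightarrow> apply_at F (Suc i) (a # w) = map_option ((#) a) (apply_at F i w)"
  by (cases i) (auto simp: apply_at_def option.map_comp comp_def nth_Cons')

lemma apply_seq_map_Suc_Cons:
  "0 \<notin> set u \<Longrightarrow> apply_seq F (map Suc u) (a # w) = map_option ((#) a) (apply_seq F u w)"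
proof (induction u arbitrary: w)
  case (Cons i u)
  then show ?case
    by (cases "apply_at F i w") (auto simp: map_comp_def apply_at_Suc_Cons Suc_le_eq)
qed simp

lemma apply_seq_append: "apply_seq F (u @ v) = apply_seq F v \<circ>\<^sub>m apply_seq F u"
  by (induction u) (auto simp: map_comp_def fun_eq_iff split: option.splits)

lemma zero_notin_delta: "0 \<notin> set (delta p)"
  by (induction p rule: delta.induct) auto

text \<open>The empty values chosen for \<open>delta 0\<close> and \<open>delta 1\<close> make the
  recursion valid from 0 on, so that inductions over words can start at the empty word.\<close>

lemma delta_Suc: "delta (Suc n) = map Suc (delta n) @ [1..<Suc n]"
  by (cases n rule: delta.cases) auto

section \<open>Products and normal words\<close>

lemma word_prod_Nil [simp]: "word_prod M [] = \<one>\<^bsub>M\<^esub>"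
  and word_prod_Cons [simp]: "word_prod M (a # w) = a \<otimes>\<^bsub>M\<^esub> word_prod M w"
  by (simp_all add: word_prod_def)

lemma normal_word_Nil [simp]: "normal_word M S []"
  by (simp add: normal_word_def)

lemma normal_word_Cons:
  "normal_word M S (a # w) \<longleftrightarrow>
     a \<in> S \<and> normal_word M S w \<and> (w \<noteq> [] \<longrightarrow> normal_pair M S a (hd w))"
  by (auto simp: normal_word_def successively_Cons)

lemma normal_word_take: "normal_word M S w \<Longrightarrow> normal_word M S (take n w)"
proof (induction w arbitrary: n)
  case (Cons a w)
  then show ?case
    by (cases n) (auto simp: normal_word_Cons hd_take)
qed simp

locale garside_monoid = monoid M for M (structure) +
  fixes S
  assumes left_cancel: "\<lbrakk>a \<in> carrier M; b \<in> carrier M; c \<in> carrier M; c \<otimes> a = c \<otimes> b\<rbrakk> \<Longrightarrow> a = b"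
    and no_units: "Units M = {\<one>}"
    and garside: "garside_family M S"
begin

lemma S_carrier: "a \<in> S \<Longrightarrow> a \<in> carrier M"
  using garside by (auto simp: garside_family_def)

lemma one_in_S: "\<one> \<in> S"
  using garside by (simp add: garside_family_def)

lemma normal_word_in_lists: "normal_word M S w \<Longrightarrow> w \<in> lists S"
  by (simp add: normal_word_def)

lemma word_prod_closed [simp]: "w \<in> lists S \<Longrightarrow> word_prod M w \<in> carrier M"
  by (induction w) (auto simp: S_carrier)

lemma word_prod_append:
  "u \<in> lists S \<Longrightarrow> v \<in> lists S \<Longrightarrow> word_prod M (u @ v) = word_prod M u \<otimes> word_prod M v"
  by (induction u) (auto simp: S_carrier m_assoc)

lemma word_prod_replicate_one [simp]: "word_prod M (replicate n \<one>) = \<one>"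
  by (induction n) auto

text \<open>Left cancellation makes a right inverse two-sided: \<open>a(ba) = (ab)a = a\<close>,
  hence \<open>ba = 1\<close>. Both factors are then units.\<close>

lemma mult_eq_one:
  assumes a: "a \<in> carrier M" and b: "b \<in> carrier M" and ab: "a \<otimes> b = \<one>"
  shows "a = \<one>" "b = \<one>"
proof -
  have "a \<otimes> (b \<otimes> a) = a \<otimes> \<one>"
    using a b ab by (simp flip: m_assoc)
  then have ba: "b \<otimes> a = \<one>"
    using a b by (intro left_cancel[of "b \<otimes> a" \<one> a]) auto
  then have "a \<in> Units M" "b \<in> Units M"
    using a b ab by (auto simp: Units_def)
  then show "a = \<one>" "b = \<one>"
    using no_units by auto
qed

lemma divides_antisym:
  assumes a: "a \<in> carrier M" and b: "b \<in> carrier M" and "a divides b" "b divides a"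
  shows "a = b"
proof -
  obtain c where c: "c \<in> carrier M" "b = a \<otimes> c"
    using \<open>a divides b\<close> by (elim dividesE)
  obtain d where d: "d \<in> carrier M" "a = b \<otimes> d"
    using \<open>b divides a\<close> by (elim dividesE)
  have "a \<otimes> (c \<otimes> d) = a \<otimes> c \<otimes> d"
    using a c(1) d(1) by (simp add: m_assoc)
  also have "\<dots> = a \<otimes> \<one>"
    using a by (simp flip: c(2) d(2))
  finally have "c \<otimes> d = \<one>"
    using a c(1) d(1) by (intro left_cancel[of "c \<otimes> d" \<one> a]) auto
  then have "c = \<one>"
    using mult_eq_one(1) c(1) d(1) by blast
  then show ?thesis
    using a c(2) by simp
qed

section \<open>Uniqueness of normal words of given length\<close>

text \<open>The induction hypothesis with multiplier \<open>f \<otimes> a\<close> discards all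
  entries after \<open>b\<close>; normality of the pair \<open>a\<close>, \<open>b\<close> then
  discards \<open>b\<close>. Quantifying over \<open>f\<close> in \<open>normal_pair\<close> is what
  makes this iterate.\<close>

lemma normal_word_divides:
  assumes "normal_word M S (a # w)" "s \<in> S" "f \<in> carrier M"
    and "s divides (f \<otimes> a \<otimes> word_prod M w)"
  shows "s divides (f \<otimes> a)"
  using assms
proof (induction w arbitrary: a f)
  case Nil
  then show ?case by (simp add: normal_word_Cons S_carrier)
next
  case (Cons b w)
  then have c: "a \<in> S" "b \<in> S" "a \<in> carrier M" "b \<in> carrier M" "word_prod M w \<in> carrier M"
    by (auto simp: normal_word_Cons S_carrier normal_word_in_lists)
  have "s divides (f \<otimes> a \<otimes> b)"
    by (rule Cons.IH) (use Cons.prems c in \<open>simp_all add: normal_word_Cons m_assoc\<close>)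
  then show ?case
    using Cons.prems by (auto simp: normal_word_Cons normal_pair_def)
qed

text \<open>The two heads divide each other, hence agree and can be cancelled. Equality of lengths
  is essential, since trailing copies of \<one> preserve normality and product.\<close>

lemma normal_word_unique:
  "\<lbrakk>normal_word M S v; normal_word M S w; length v = length w;
    word_prod M v = word_prod M w\<rbrakk> \<Longrightarrow> v = w"
proof (induction v arbitrary: w)
  case (Cons a v)
  then obtain b u where w: "w = b # u"
    by (cases w) auto
  have c: "a \<in> S" "b \<in> S" "a \<in> carrier M" "b \<in> carrier M"
      "word_prod M v \<in> carrier M" "word_prod M u \<in> carrier M"
    using Cons.prems w by (auto simp: normal_word_Cons S_carrier normal_word_in_lists)
  have eq: "a \<otimes> word_prod M v = b \<otimes> word_prod M u"
    using Cons.prems w by simp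
  have "a divides (\<one> \<otimes> b)"
    using Cons.prems(2) c w eq[symmetric] by (intro normal_word_divides[of b u]) auto
  moreover have "b divides (\<one> \<otimes> a)"
    using Cons.prems(1) c eq by (intro normal_word_divides[of a v]) auto
  ultimately have ab: "a = b"
    using c by (intro divides_antisym) auto
  then have "word_prod M v = word_prod M u"
    using c eq by (intro left_cancel[of "word_prod M v" "word_prod M u" a]) auto
  then have "v = u"
    using Cons.prems w by (intro Cons.IH) (auto simp: normal_word_Cons)
  with w ab show ?case
    by simp
qed simp

text \<open>The factor \<open>g\<close> is what remains of the first entries of \<open>t\<close> after absorbing those of \<open>w\<close>.\<close>

lemma normal_word_excess:
  assumes "normal_word M S t" "w \<in> lists S" "g \<in> carrier M"
    and "word_prod M w = g \<otimes> word_prod M t"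
  shows "word_prod M (drop (length w) t) = \<one>"
  using assms
proof (induction w arbitrary: t g)
  case Nil
  then show ?case
    using mult_eq_one(2)[of g "word_prod M t"] by (simp add: normal_word_in_lists)
next
  case (Cons s w)
  show ?case
  proof (cases t)
    case Nil
    then show ?thesis by simp
  next
    case t: (Cons a u)
    have c: "a \<in> S" "s \<in> S" "a \<in> carrier M" "s \<in> carrier M"
        "word_prod M w \<in> carrier M" "word_prod M u \<in> carrier M"
      using Cons.prems t by (auto simp: normal_word_Cons S_carrier normal_word_in_lists)
    have eq: "s \<otimes> word_prod M w = g \<otimes> a \<otimes> word_prod M u"
      using Cons.prems t c by (simp add: m_assoc)
    have "s divides (g \<otimes> a \<otimes> word_prod M u)"
      unfolding eq[symmetric] using c(5) by (rule dividesI) (rule refl)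
    then have "s divides (g \<otimes> a)"
      using Cons.prems t c by (intro normal_word_divides[of a u]) auto
    \<comment> \<open>Once \<open>s\<close> is cancelled, the cofactor \<open>h\<close> takes over
      the role of \<open>g\<close>.\<close>
    then obtain h where h: "h \<in> carrier M" "g \<otimes> a = s \<otimes> h"
      by (auto elim: dividesE)
    have "s \<otimes> word_prod M w = s \<otimes> (h \<otimes> word_prod M u)"
      unfolding eq h(2) using c h(1) by (intro m_assoc) auto
    then have "word_prod M w = h \<otimes> word_prod M u"
      by (rule left_cancel[rotated 3]) (use c h in auto)
    then have "word_prod M (drop (length w) u) = \<one>"
      using Cons.prems t h by (intro Cons.IH[of u h]) (auto simp: normal_word_Cons)
    with t show ?thesis
      by simp
  qed
qed

section \<open>Existence of normal forms of prescribed length\<close>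

lemma normal_pair_one: "a \<in> S \<Longrightarrow> normal_pair M S a \<one>"
  unfolding normal_pair_def by (metis S_carrier m_closed r_one)

lemma normal_word_replicate_one: "normal_word M S (replicate n \<one>)"
proof (induction n)
  case (Suc n)
  then show ?case
    using one_in_S by (cases n) (simp_all add: normal_word_Cons normal_pair_one)
qed simp

lemma normal_word_pad: "normal_word M S w \<Longrightarrow> normal_word M S (w @ replicate n \<one>)"
proof (induction w)
  case Nil
  show ?case
    by (simp add: normal_word_replicate_one)
next
  case (Cons a w)
  then have a: "a \<in> S" and IH: "normal_word M S (w @ replicate n \<one>)"
    by (simp_all add: normal_word_Cons)
  \<comment> \<open>Only at the junction does a new pair arise, and its second entry is
    \<one>.\<close>
  have "normal_pair M S a (hd (w @ replicate n \<one>))" if "w @ replicate n \<one> \<noteq> []"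
  proof (cases w)
    case Nil
    with that a show ?thesis
      by (simp add: normal_pair_one)
  next
    case (Cons b v)
    with \<open>normal_word M S (a # w)\<close> show ?thesis
      by (simp add: normal_word_Cons)
  qed
  with a IH show ?case
    by (simp add: normal_word_Cons)
qed

text \<open>A normal decomposition given by the Garside property may have the wrong length: if short
  it is padded with \<one>, if long it is truncated, the surplus having product \<one>.\<close>

lemma normal_form_exists:
  assumes w: "w \<in> lists S"
  shows "\<exists>v. normal_form_of M S w v"
proof -
  have "\<forall>g\<in>carrier M. \<exists>t. normal_word M S t \<and> word_prod M t = g"
    using garside by (simp add: garside_family_def)
  from bspec[OF this word_prod_closed[OF w]]
  obtain t where t: "normal_word M S t" "word_prod M t = word_prod M w"
    by (elim exE conjE)
  show ?thesis
  proof (cases "length t \<le> length w")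
    case True
    have "replicate (length w - length t) \<one> \<in> lists S"
      using one_in_S by auto
    moreover have "t \<in> lists S" "word_prod M w \<in> carrier M"
      using t w by (simp_all add: normal_word_in_lists)
    ultimately have "normal_form_of M S w (t @ replicate (length w - length t) \<one>)"
      using True t by (simp add: normal_form_of_def normal_word_pad word_prod_append)
    then show ?thesis ..
  next
    case False
    have "t \<in> lists S"
      using t by (simp add: normal_word_in_lists)
    then have l: "take (length w) t \<in> lists S" "drop (length w) t \<in> lists S"
      by (auto dest: in_set_takeD in_set_dropD)
    have "word_prod M (drop (length w) t) = \<one>"
      using t w by (intro normal_word_excess[of t w \<one>]) auto
    then have "word_prod M (take (length w) t) = word_prod M t"
      using word_prod_append[OF l] l by simp
    then have "normal_form_of M S w (take (length w) t)"
      using False t by (simp add: normal_form_of_def normal_word_take)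
    then show ?thesis ..
  qed
qed

lemma normal_form_unique:
  "normal_form_of M S w v \<Longrightarrow> normal_form_of M S w v' \<Longrightarrow> v = v'"
  by (rule normal_word_unique) (auto simp: normal_form_of_def)

lemma NS_eqI: "normal_form_of M S w v \<Longrightarrow> NS M S w = v"
  unfolding NS_def by (blast intro: normal_form_unique)

lemma normal_form_of_NS: "w \<in> lists S \<Longrightarrow> normal_form_of M S w (NS M S w)"
  using normal_form_exists NS_eqI by metis

section \<open>Computing normal forms by local normalisation\<close>

lemma normalise_pair:
  assumes "a \<in> S" "b \<in> S"
  obtains c d where "NS_bar M S [a, b] = Some [c, d]" "c \<in> S" "d \<in> S"
    "normal_pair M S c d" "a \<otimes> b = c \<otimes> d"
proof -
  have nf: "normal_form_of M S [a, b] (NS M S [a, b])"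
    using assms by (intro normal_form_of_NS) auto
  then obtain c d where cd: "NS M S [a, b] = [c, d]"
    by (auto simp: normal_form_of_def length_Suc_conv)
  with nf assms have "c \<in> S" "d \<in> S" "normal_pair M S c d" "a \<otimes> b = c \<otimes> d"
    by (auto simp: normal_form_of_def normal_word_Cons S_carrier)
  with cd assms show thesis
    by (intro that[of c d]) (auto simp: NS_bar_def)
qed

text \<open>One pass from left to right suffices: each step fixes one entry for good and carries a
  remainder into the rest of the word. The last position is \<open>length t\<close>, as
  \<open>s # t\<close> has one more entry.\<close>

lemma apply_seq_insert:
  "\<lbrakk>s \<in> S; normal_word M S t\<rbrakk> \<Longrightarrow>
    \<exists>v. apply_seq (NS_bar M S) [1..<Suc (length t)] (s # t) = Some v \<and>
        normal_form_of M S (s # t) v"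
proof (induction t arbitrary: s)
  case Nil
  then show ?case by (simp add: normal_form_of_def normal_word_Cons)
next
  case (Cons a t)
  have a: "a \<in> S" and t: "normal_word M S t" "t \<in> lists S"
    using Cons.prems by (auto simp: normal_word_Cons normal_word_in_lists)
  \<comment> \<open>Here \<open>c\<close> is the final first entry, and \<open>d\<close> is the
    letter to be inserted into \<open>t\<close>.\<close>
  obtain c d where cd: "NS_bar M S [s, a] = Some [c, d]" "c \<in> S" "d \<in> S"
      "normal_pair M S c d" "s \<otimes> a = c \<otimes> d"
    using normalise_pair Cons.prems(1) a by metis
  obtain v where v: "apply_seq (NS_bar M S) [1..<Suc (length t)] (d # t) = Some v"
      and nf: "normal_form_of M S (d # t) v"
    using Cons.IH[of d] t cd by blast
  have "v \<noteq> []"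
    using nf by (auto simp: normal_form_of_def)
  then obtain e u where vu: "v = e # u"
    by (cases v) auto
  have v_prod: "e \<otimes> word_prod M u = d \<otimes> word_prod M t" and nv: "normal_word M S v"
    and lv: "length v = Suc (length t)"
    using nf vu by (auto simp: normal_form_of_def)
  have car: "s \<in> carrier M" "a \<in> carrier M" "c \<in> carrier M" "d \<in> carrier M" "e \<in> carrier M"
      "word_prod M u \<in> carrier M" "word_prod M t \<in> carrier M"
    using Cons.prems a t cd nv vu by (auto simp: S_carrier normal_word_Cons normal_word_in_lists)
  \<comment> \<open>This is the domino rule: the fixed entry \<open>c\<close> must stay compatible
    with the head \<open>e\<close> produced by the later steps.\<close>
  have "normal_pair M S c e"
    unfolding normal_pair_def
  proof (intro ballI impI)
    fix r f
    assume r: "r \<in> S" and f: "f \<in> carrier M" and dvd: "r divides (f \<otimes> c \<otimes> e)"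
    \<comment> \<open>Multiplying by the rest of \<open>v\<close> turns the product into
      \<open>f\<close> times that of \<open>s # a # t\<close>. Normality of \<open>a # t\<close>
      with multiplier \<open>f \<otimes> s\<close>, then that of \<open>c\<close>, \<open>d\<close>,
      reduces it to \<open>f \<otimes> c\<close>.\<close>
    have "r divides (f \<otimes> c \<otimes> e \<otimes> word_prod M u)"
      by (rule divides_prod_r) (use dvd r f car in \<open>auto simp: S_carrier\<close>)
    also have "f \<otimes> c \<otimes> e \<otimes> word_prod M u = f \<otimes> (c \<otimes> d) \<otimes> word_prod M t"
      using f car v_prod by (simp add: m_assoc)
    also have "\<dots> = (f \<otimes> s) \<otimes> a \<otimes> word_prod M t"
      using f car by (simp add: m_assoc flip: cd(5))
    finally have "r divides ((f \<otimes> s) \<otimes> a)"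
      by (rule normal_word_divides[OF Cons.prems(2) r, rotated]) (use f car in auto)
    then have "r divides (f \<otimes> c \<otimes> d)"
      using f car cd(5) by (simp add: m_assoc)
    then show "r divides (f \<otimes> c)"
      using cd(4) r f by (simp add: normal_pair_def)
  qed
  then have "normal_word M S (c # v)"
    using cd nv vu by (simp add: normal_word_Cons)
  moreover have "c \<otimes> word_prod M v = s \<otimes> (a \<otimes> word_prod M t)"
    using car cd(5) v_prod vu by (simp flip: m_assoc)
  ultimately have form: "normal_form_of M S (s # a # t) (c # v)"
    using lv by (simp add: normal_form_of_def)
  have upt: "[1..<Suc (length (a # t))] = 1 # map Suc [1..<Suc (length t)]"
    by (simp add: map_Suc_upt upt_conv_Cons del: upt_Suc)
  have "apply_seq (NS_bar M S) [1..<Suc (length (a # t))] (s # a # t) =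
      apply_seq (NS_bar M S) (map Suc [1..<Suc (length t)]) (c # d # t)"
    unfolding upt using cd(1) by (simp add: apply_at_def map_comp_def del: upt_Suc)
  also have "\<dots> = Some (c # v)"
    using v by (subst apply_seq_map_Suc_Cons) (simp_all del: upt_Suc)
  finally show ?case
    using form by (intro exI conjI)
qed

text \<open>The induction mirrors the recursion of \<open>delta\<close>: the shifted part normalises
  the tail, and the final run of positions inserts the first letter. The value \<open>Some v\<close>
  also records that every step is defined.\<close>

lemma apply_seq_delta:
  "w \<in> lists S \<Longrightarrow>
    \<exists>v. apply_seq (NS_bar M S) (delta (length w)) w = Some v \<and> normal_form_of M S w v"
proof (induction w)
  case Nil
  then show ?case by (simp add: normal_form_of_def)
next
  case (Cons s w)
  then obtain t where t: "apply_seq (NS_bar M S) (delta (length w)) w = Some t"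
      "normal_form_of M S w t"
    by auto
  have "length t = length w" "normal_word M S t"
    using t(2) by (simp_all add: normal_form_of_def)
  then obtain v where v: "apply_seq (NS_bar M S) [1..<Suc (length w)] (s # t) = Some v"
      "normal_form_of M S (s # t) v"
    using apply_seq_insert[of s t] Cons.prems by (auto simp del: upt_Suc)
  have "apply_seq (NS_bar M S) (map Suc (delta (length w))) (s # w) = Some (s # t)"
    using t(1) by (simp add: apply_seq_map_Suc_Cons zero_notin_delta)
  then have "apply_seq (NS_bar M S) (delta (length (s # w))) (s # w) = Some v"
    using v(1) by (simp add: delta_Suc apply_seq_append map_comp_def del: upt_Suc)
  \<comment> \<open>Replacing the tail \<open>w\<close> by its normal form \<open>t\<close> changes
    neither length nor product.\<close>
  moreover have "normal_form_of M S (s # w) v"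
    using v(2) t(2) by (simp add: normal_form_of_def)
  ultimately show ?case
    by blast
qed

end

theorem proposition3p10:
  fixes M :: "('a, 'b) monoid_scheme" and S :: "'a set"
  assumes "monoid M"
    and left_cancel: "\<And>a b c. \<lbrakk>a \<in> carrier M; b \<in> carrier M; c \<in> carrier M;
          c \<otimes>\<^bsub>M\<^esub> a = c \<otimes>\<^bsub>M\<^esub> b\<rbrakk> \<Longrightarrow> a = b"
    and no_units: "Units M = {\<one>\<^bsub>M\<^esub>}"
    and garside: "garside_family M S"
  shows "\<forall>p. \<forall>w\<in>lists S. length w = p \<longrightarrow>
           (\<exists>!v. normal_word M S v \<and> length v = p \<and> word_prod M v = word_prod M w) \<and>
           (p \<ge> 2 \<longrightarrow> apply_seq (NS_bar M S) (delta p) w = Some (NS M S w))"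
proof (intro allI ballI impI)
  interpret monoid M by fact
  interpret garside_monoid M S
    by unfold_locales (fact left_cancel no_units garside)+
  fix p w
  assume w: "w \<in> lists S" and p: "length w = p"
  have "\<exists>!v. normal_form_of M S w v"
    using normal_form_exists[OF w] normal_form_unique by blast
  then have unique: "\<exists>!v. normal_word M S v \<and> length v = p \<and> word_prod M v = word_prod M w"
    by (simp add: normal_form_of_def p)
  obtain v where v: "apply_seq (NS_bar M S) (delta p) w = Some v"
      "normal_form_of M S w v"
    using apply_seq_delta[OF w] unfolding p by (elim exE conjE)
  have "apply_seq (NS_bar M S) (delta p) w = Some (NS M S w)"
    using v(1) NS_eqI[OF v(2)] by simp
  then show "(\<exists>!v. normal_word M S v \<and> length v = p \<and> word_prod M v = word_prod M w) \<and>
      (p \<ge> 2 \<longrightarrow> apply_seq (NS_bar M S) (delta p) w = Some (NS M S w))"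
    using unique by simp
qed

end
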